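(* Let $s,k\ge 2$ be integers. For each positive integer $n$, let $X^1,\dots,X^k$ be lattice points chosen independently and uniformly at random from $\{1,\dots,n\}^s$ (repetitions allowed). Then $$\lim_{n\to\infty}\mathbb P\left(X^1\diamond X^2,\ X^2\diamond X^3,\ \dots,\ X^{k-1}\diamond X^k,\ X^k\diamond X^1\right)=\zeta(s)^{-k}\prod_p\left(1+\frac{(-1)^k}{(p^s-1)^{k-1}}\right),$$ where the product runs over all primes $p$ and $\zeta$ is the Riemann zeta function.
   Context: Two distinct points $X,Y\in\mathbb Z^s$ are called mutually visible, written $X\diamond Y$, if the closed line segment joining them contains no lattice point of $\mathbb Z^s$ other than $X$ and $Y$. (In particular $X\diamond Y$ requires $X\neq Y$.) *)

theory Defs
  imports
    "HOL-Analysis.Analysis"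
    "HOL-Probability.Product_PMF"
    "HOL-Computational_Algebra.Primes"
begin

definition real_vec :: "int ^ 'i \<Rightarrow> real ^ 'i" where
  "real_vec x = (\<chi> j. real_of_int (x $ j))"

definition mutually_visible :: "int ^ 'i \<Rightarrow> int ^ 'i \<Rightarrow> bool" (infix \<open>\<diamond>\<close> 50) where
  "X \<diamond> Y \<longleftrightarrow> X \<noteq> Y \<and>
     (\<forall>Z. real_vec Z \<in> closed_segment (real_vec X) (real_vec Y) \<longrightarrow> Z = X \<or> Z = Y)"

definition lattice_box :: "nat \<Rightarrow> (int ^ 'i) set" where
  "lattice_box n = {x. \<forall>j. x $ j \<in> {1..int n}}"

(* Joint law of k independent uniform points, indexed by {1..k}; the value of such a function
   outside {1..k} is the irrelevant constant 0.  Meaningful for n > 0 only: for n = 0 the box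
   is empty. *)
definition random_points :: "nat \<Rightarrow> nat \<Rightarrow> (nat \<Rightarrow> int ^ 'i) pmf" where
  "random_points k n = Pi_pmf {1..k} 0 (\<lambda>_. pmf_of_set (lattice_box n))"

(* The Dirichlet series, hence the Riemann zeta function at integers s > 1 only. *)
definition zeta :: "nat \<Rightarrow> real" where
  "zeta s = (\<Sum>m. 1 / real (Suc m) ^ s)"

end

(* Two lattice points are mutually visible iff no prime divides all coordinates of their difference.
   For the primes below N this condition on a closed k-chain only depends on the residues of the
   points, so by the Chinese remainder theorem its probability tends to a product of local factors.
   The factor at p is the proportion of proper colourings of a k-cycle among all colourings with
   q = p^s colours; there are (q - 1)^k + (-1)^k (q - 1) proper ones. Uniformly in n, the primes
   from N on contribute at most a constant times the sum of d^(-s) over d >= N, plus the probability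
   O(n^(-s)) that two neighbouring points coincide. *)
theory Submission
  imports Defs
begin

subsection \<open>Residues of uniform points\<close>

text \<open>The obstacle is the order of the limits. For fixed N the limit in n is a finite product,
  but the sandwich that yields it depends on the product of all primes below N. Hence the large
  primes need an error bound that does not involve n, and \<open>tendsto_by_approximation\<close>
  then chooses N before n. A residue class modulo d has about (n/d)^s points of the box only while d
  is at most n. For larger d it still contains the given point, and counting this point once for
  each d would diverge. This is why coincidences are split off. The k conditions on a closed chain
  are not independent modulo p, so the local factor needs the colouring count. For the tail, a union
  bound over the k edges is enough, and it uses only that two points are independent. With q = p^s
  the local factor is (1 - 1/q)^k * (1 + (-1)^k / (q - 1)^(k - 1)). The first parts multiply to
  zeta(s)^(-k) by the Euler product, and the second parts are the product in the theorem.\<close>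

definition configs :: "nat \<Rightarrow> nat \<Rightarrow> (nat \<Rightarrow> int ^ 'i) set" where
  "configs k n = PiE_dflt {1..k} 0 (\<lambda>_. lattice_box n)"

lemma card_vec_Pi:
  fixes B :: "'i::finite \<Rightarrow> 'a set"
  shows "card {x :: 'a ^ 'i. \<forall>j. x $ j \<in> B j} = (\<Prod>j\<in>UNIV. card (B j))"
proof -
  have "bij_betw vec_nth {x :: 'a ^ 'i. \<forall>j. x $ j \<in> B j} (Pi\<^sub>E UNIV B)"
    by (rule bij_betwI[where g = vec_lambda]) (auto simp: PiE_def)
  then show ?thesis
    by (simp add: bij_betw_same_card card_PiE)
qed

lemma card_lattice_box: "card (lattice_box n :: (int ^ 'i::finite) set) = n ^ CARD('i)"
  using card_vec_Pi[of "\<lambda>_ :: 'i. {1..int n}"] by (simp add: lattice_box_def)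

lemma lattice_box_nonempty: "n > 0 \<Longrightarrow> (lattice_box n :: (int ^ 'i::finite) set) \<noteq> {}"
  by (auto simp: lattice_box_def intro!: exI[of _ "\<chi> _. 1"])

lemma finite_lattice_box [simp]: "finite (lattice_box n :: (int ^ 'i::finite) set)"
proof (cases "n = 0")
  case True
  then show ?thesis by (simp add: lattice_box_def)
next
  case False
  then have "card (lattice_box n :: (int ^ 'i) set) > 0" by (simp add: card_lattice_box)
  then show ?thesis using card_gt_0_iff by blast
qed

lemma finite_configs [simp]: "finite (configs k n :: (nat \<Rightarrow> int ^ 'i::finite) set)"
  unfolding configs_def by (rule finite_PiE_dflt) auto

lemma card_configs: "card (configs k n :: (nat \<Rightarrow> int ^ 'i::finite) set) = (n ^ CARD('i)) ^ k"
  unfolding configs_def by (subst card_PiE_dflt) (auto simp: card_lattice_box)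

text \<open>From here on probabilities are counts: a product of uniform laws is uniform on the
  product set. The default value 0 in \<open>configs\<close> is the one in
  \<open>random_points\<close>.\<close>

lemma random_points_eq:
  assumes "n > 0"
  shows "(random_points k n :: (nat \<Rightarrow> int ^ 'i::finite) pmf) = pmf_of_set (configs k n)"
  unfolding random_points_def configs_def
  by (rule Pi_pmf_of_set) (use assms in \<open>auto simp: lattice_box_nonempty\<close>)

lemma prob_random_points:
  fixes S :: "(nat \<Rightarrow> int ^ 'i::finite) set"
  assumes "n > 0"
  shows "measure_pmf.prob (random_points k n) S = card (S \<inter> configs k n) / (real n ^ CARD('i)) ^ k"
proof -
  have "card (configs k n :: (nat \<Rightarrow> int ^ 'i) set) \<noteq> 0"
    using assms by (simp add: card_configs)
  then have "configs k n \<noteq> ({} :: (nat \<Rightarrow> int ^ 'i) set)" by fastforce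
  then show ?thesis
    by (simp add: random_points_eq[OF assms] measure_pmf_of_set card_configs Int_commute)
qed

text \<open>The value 0 outside \<open>{1..k}\<close> keeps the image inside \<open>configs\<close>,
  whatever \<open>f 0\<close> is.\<close>

definition lift_coords :: "nat \<Rightarrow> (int \<Rightarrow> int) \<Rightarrow> (nat \<Rightarrow> int ^ 'i) \<Rightarrow> (nat \<Rightarrow> int ^ 'i)" where
  "lift_coords k f X = (\<lambda>j. if j \<in> {1..k} then \<chi> i. f (X j $ i) else 0)"

text \<open>A bijection of the interval acts on all coordinates of all k points at once, and so
  splits a configuration into a pair of configurations. It is used with (residue, quotient) to pass
  to multiples of a modulus, and with (residue, residue) for the Chinese remainder theorem.\<close>

lemma card_configs_split:
  fixes S :: "(nat \<Rightarrow> int ^ 'i::finite) set"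
  assumes bij: "bij_betw (\<lambda>x. (f x, g x)) {1..int (a * b)} ({1..int a} \<times> {1..int b})"
    and S: "\<And>X. X \<in> configs k (a * b) \<Longrightarrow>
              X \<in> S \<longleftrightarrow> lift_coords k f X \<in> S1 \<and> lift_coords k g X \<in> S2"
  shows "card (S \<inter> configs k (a * b)) = card (S1 \<inter> configs k a) * card (S2 \<inter> configs k b)"
proof -
  let ?h = "\<lambda>X :: nat \<Rightarrow> int ^ 'i. (lift_coords k f X, lift_coords k g X)"
  have fg: "f x \<in> {1..int a} \<and> g x \<in> {1..int b}" if "x \<in> {1..int (a * b)}" for x
    using bij_betwE[OF bij] that by blast
  have inj: "inj_on ?h (configs k (a * b))"
  proof (rule inj_onI)
    fix X Y :: "nat \<Rightarrow> int ^ 'i"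
    assume X: "X \<in> configs k (a * b)" and Y: "Y \<in> configs k (a * b)" and eq: "?h X = ?h Y"
    show "X = Y"
    proof
      fix j
      show "X j = Y j"
      proof (cases "j \<in> {1..k}")
        case True
        have "X j $ i = Y j $ i" for i
        proof (rule inj_onD[OF bij_betw_imp_inj_on[OF bij]])
          show "X j $ i \<in> {1..int (a * b)}" "Y j $ i \<in> {1..int (a * b)}"
            using X Y True by (auto simp: configs_def PiE_dflt_def lattice_box_def)
          have "lift_coords k f X j $ i = lift_coords k f Y j $ i"
               "lift_coords k g X j $ i = lift_coords k g Y j $ i" using eq by simp_all
          then show "(f (X j $ i), g (X j $ i)) = (f (Y j $ i), g (Y j $ i))"
            using True by (simp add: lift_coords_def)
        qed
        then show ?thesis by (simp add: vec_eq_iff)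
      next
        case False
        then have "X j = 0" "Y j = 0" using X Y by (auto simp: configs_def PiE_dflt_def)
        then show ?thesis by simp
      qed
    qed
  qed
  have into: "?h ` configs k (a * b) \<subseteq> configs k a \<times> configs k b"
    using fg by (auto simp: configs_def PiE_dflt_def lattice_box_def lift_coords_def)
  \<comment> \<open>Surjectivity comes from counting: with s the dimension, both sides have (a b)^(s
    k) elements.\<close>
  have "card (?h ` configs k (a * b)) = card (configs k a \<times> configs k b :: ((nat \<Rightarrow> int ^ 'i) \<times> (nat \<Rightarrow> int ^ 'i)) set)"
    by (simp add: card_image[OF inj] card_cartesian_product card_configs power_mult_distrib)
  then have img: "?h ` configs k (a * b) = configs k a \<times> configs k b"
    by (intro card_subset_eq into) auto
  have "?h ` (S \<inter> configs k (a * b)) = (S1 \<inter> configs k a) \<times> (S2 \<inter> configs k b)"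
  proof
    show "?h ` (S \<inter> configs k (a * b)) \<subseteq> (S1 \<inter> configs k a) \<times> (S2 \<inter> configs k b)"
      using into S by (auto simp: image_subset_iff)
    show "(S1 \<inter> configs k a) \<times> (S2 \<inter> configs k b) \<subseteq> ?h ` (S \<inter> configs k (a * b))"
    proof
      fix z assume z: "z \<in> (S1 \<inter> configs k a) \<times> (S2 \<inter> configs k b)"
      then have "z \<in> ?h ` configs k (a * b)" using img by auto
      then obtain X where "X \<in> configs k (a * b)" "z = ?h X" by blast
      with z S show "z \<in> ?h ` (S \<inter> configs k (a * b))" by auto
    qed
  qed
  moreover have "inj_on ?h (S \<inter> configs k (a * b))" using inj by (rule inj_on_subset) auto
  ultimately have "card (S \<inter> configs k (a * b)) = card ((S1 \<inter> configs k a) \<times> (S2 \<inter> configs k b))"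
    using card_image[of ?h "S \<inter> configs k (a * b)"] by simp
  then show ?thesis by (simp only: card_cartesian_product)
qed

text \<open>The representatives run from 1 to m instead of 0 to m - 1, so that they are again
  coordinates of a lattice box.\<close>

definition residue :: "nat \<Rightarrow> int \<Rightarrow> int" where
  "residue m x = (x - 1) mod int m + 1"

lemma residue_in: "m > 0 \<Longrightarrow> residue m x \<in> {1..int m}"
  unfolding residue_def using pos_mod_bound[of "int m" "x - 1"] pos_mod_sign[of "int m" "x - 1"]
  by (simp del: pos_mod_bound)

lemma residue_mod: "residue m x mod int m = x mod int m"
  unfolding residue_def by (simp add: mod_simps)

lemma residue_eq_iff: "residue m x = residue m y \<longleftrightarrow> x mod int m = y mod int m"
proof
  assume "residue m x = residue m y" then show "x mod int m = y mod int m"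
    using residue_mod by metis
next
  assume "x mod int m = y mod int m" then show "residue m x = residue m y"
    unfolding residue_def by (metis mod_diff_left_eq)
qed

lemma div_int_less:
  fixes x a b :: int
  assumes "x < a * b" "a > 0"
  shows "x div a < b"
proof (rule ccontr)
  assume "\<not> x div a < b"
  then have "a * b \<le> a * (x div a)" using assms(2) by simp
  also have "\<dots> \<le> x" using mult_div_mod_eq[of a x] pos_mod_sign[OF assms(2), of x] by linarith
  finally show False using assms(1) by simp
qed

text \<open>This is division with remainder applied to x - 1, with remainder and quotient both
  shifted to start at 1.\<close>

lemma bij_betw_residue_div:
  assumes "a > 0"
  shows "bij_betw (\<lambda>x. (residue a x, (x - 1) div int a + 1)) {1..int (a * b)} ({1..int a} \<times> {1..int b})"
proof (rule bij_betwI[where g = "\<lambda>(u, v). u + int a * (v - 1)"])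
  show "(\<lambda>x. (residue a x, (x - 1) div int a + 1)) \<in> {1..int (a * b)} \<rightarrow> {1..int a} \<times> {1..int b}"
  proof
    fix x assume x: "x \<in> {1..int (a * b)}"
    then have "(x - 1) div int a \<ge> 0" using assms by (simp add: pos_imp_zdiv_nonneg_iff)
    moreover have "(x - 1) div int a < int b"
      using x assms by (intro div_int_less) auto
    ultimately show "(residue a x, (x - 1) div int a + 1) \<in> {1..int a} \<times> {1..int b}"
      using residue_in[OF assms] by auto
  qed
  show "(\<lambda>(u, v). u + int a * (v - 1)) \<in> {1..int a} \<times> {1..int b} \<rightarrow> {1..int (a * b)}"
  proof clarify
    fix u v assume u: "u \<in> {1..int a}" and v: "v \<in> {1..int b}"
    have "int a * (v - 1) \<ge> 0" using v by simp
    moreover have "int a * (v - 1) \<le> int a * (int b - 1)" using v by (intro mult_left_mono) auto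
    ultimately show "u + int a * (v - 1) \<in> {1..int (a * b)}"
      using u unfolding atLeastAtMost_iff of_nat_mult right_diff_distrib by linarith
  qed
next
  fix x assume "x \<in> {1..int (a * b)}"
  show "(\<lambda>(u, v). u + int a * (v - 1)) (residue a x, (x - 1) div int a + 1) = x"
    unfolding residue_def using mod_mult_div_eq[of "x - 1" "int a"] by simp
next
  fix y assume y: "y \<in> {1..int a} \<times> {1..int b}"
  obtain u v where uv: "y = (u, v)" by (cases y)
  have w: "u + int a * (v - 1) - 1 = u - 1 + int a * (v - 1)" by simp
  have u: "u - 1 \<ge> 0" "u - 1 < int a" using y uv by auto
  then have m: "(u - 1 + int a * (v - 1)) mod int a = u - 1"
    by (simp only: mod_mult_self2 mod_pos_pos_trivial)
  have d: "(u - 1 + int a * (v - 1)) div int a = v - 1"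
    using u assms by (subst div_mult_self2) (simp_all add: div_pos_pos_trivial)
  show "(residue a ((\<lambda>(u, v). u + int a * (v - 1)) y),
         ((\<lambda>(u, v). u + int a * (v - 1)) y - 1) div int a + 1) = y"
    unfolding residue_def uv prod.case w m d by simp
qed

text \<open>Chinese remainder theorem: two points with the same image differ by a multiple of a b
  that is smaller than a b in absolute value, and surjectivity follows by counting.\<close>

lemma bij_betw_residue_residue:
  assumes "coprime a b" "a > 0" "b > 0"
  shows "bij_betw (\<lambda>x. (residue a x, residue b x)) {1..int (a * b)} ({1..int a} \<times> {1..int b})"
proof -
  let ?h = "\<lambda>x. (residue a x, residue b x)"
  have inj: "inj_on ?h {1..int (a * b)}"
  proof (rule inj_onI)
    fix x y assume x: "x \<in> {1..int (a * b)}" and y: "y \<in> {1..int (a * b)}" and "?h x = ?h y"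
    then have "int a dvd x - y" "int b dvd x - y"
      by (auto simp: residue_eq_iff mod_eq_dvd_iff)
    then have "int a * int b dvd x - y" using assms by (intro divides_mult) auto
    then have "int (a * b) dvd x - y" by simp
    moreover have "\<bar>x - y\<bar> < int (a * b)" using x y unfolding atLeastAtMost_iff by linarith
    ultimately show "x = y" using dvd_imp_le_int[of "x - y" "int (a * b)"] by linarith
  qed
  have into: "?h ` {1..int (a * b)} \<subseteq> {1..int a} \<times> {1..int b}" using residue_in assms by blast
  have "?h ` {1..int (a * b)} = {1..int a} \<times> {1..int b}"
    by (rule card_subset_eq[OF _ into]) (simp_all add: card_image[OF inj] card_cartesian_product del: of_nat_mult)
  with inj show ?thesis by (simp add: bij_betw_def)
qed

section \<open>Events that depend only on residues\<close>

definition periodic :: "nat \<Rightarrow> nat \<Rightarrow> (nat \<Rightarrow> int ^ 'i) set \<Rightarrow> bool" where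
  "periodic k m S \<longleftrightarrow> (\<forall>X Y. (\<forall>j\<in>{1..k}. \<forall>i. X j $ i mod int m = Y j $ i mod int m) \<longrightarrow>
     (X \<in> S \<longleftrightarrow> Y \<in> S))"

lemma periodic_lift_residue:

  assumes "periodic k m S"
  shows "lift_coords k (residue m) X \<in> S \<longleftrightarrow> X \<in> S"
  by (rule assms[unfolded periodic_def, rule_format]) (simp add: lift_coords_def residue_mod)

lemma periodic_mult: "periodic k m S \<Longrightarrow> periodic k (m * n) S"
  unfolding periodic_def
proof (intro allI impI)
  fix X Y :: "nat \<Rightarrow> int ^ 'a"
  assume per: "\<forall>X Y. (\<forall>j\<in>{1..k}. \<forall>i. X j $ i mod int m = Y j $ i mod int m) \<longrightarrow> (X \<in> S \<longleftrightarrow> Y \<in> S)"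
    and eq: "\<forall>j\<in>{1..k}. \<forall>i. X j $ i mod int (m * n) = Y j $ i mod int (m * n)"
  have "X j $ i mod int m = Y j $ i mod int m" if "j \<in> {1..k}" for j i
    using arg_cong[OF eq[rule_format, OF that, of i], of "\<lambda>x. x mod int m"] by (simp add: mod_mod_cancel)
  then show "X \<in> S \<longleftrightarrow> Y \<in> S" using per by blast
qed

lemma periodic_Int: "periodic k m S \<Longrightarrow> periodic k m T \<Longrightarrow> periodic k m (S \<inter> T)"
  unfolding periodic_def by blast

text \<open>The larger box is tiled by translates of the box of side m, and each point chooses its
  tile freely. So the frequency of a periodic event is the same at every positive multiple of its
  modulus.\<close>

lemma card_periodic_multiple:
  fixes S :: "(nat \<Rightarrow> int ^ 'i::finite) set"
  assumes "periodic k m S" "m > 0"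
  shows "card (S \<inter> configs k (m * t)) = card (S \<inter> configs k m) * (t ^ CARD('i)) ^ k"
proof -
  \<comment> \<open>The quotients are unconstrained, hence \<open>UNIV\<close> as the second
    event.\<close>
  have "card (S \<inter> configs k (m * t)) = card (S \<inter> configs k m) * card (UNIV \<inter> (configs k t :: (nat \<Rightarrow> int ^ 'i) set))"
    by (rule card_configs_split[OF bij_betw_residue_div[OF assms(2)]])
      (simp add: periodic_lift_residue[OF assms(1)])
  then show ?thesis by (simp add: card_configs)
qed

text \<open>In a box of side a b the residues modulo a and modulo b are exactly independent, so no
  error term arises.\<close>

lemma prob_periodic_Int:
  fixes S T :: "(nat \<Rightarrow> int ^ 'i::finite) set"
  assumes "periodic k a S" "periodic k b T" "coprime a b" "a > 0" "b > 0"
  shows "measure_pmf.prob (random_points k (a * b)) (S \<inter> T) =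
    measure_pmf.prob (random_points k a) S * measure_pmf.prob (random_points k b) T"
proof -
  have "card ((S \<inter> T) \<inter> configs k (a * b)) = card (S \<inter> configs k a) * card (T \<inter> configs k b)"
    by (rule card_configs_split[OF bij_betw_residue_residue[OF assms(3-5)]])
      (simp add: periodic_lift_residue[OF assms(1)] periodic_lift_residue[OF assms(2)])
  then show ?thesis using assms by (simp add: prob_random_points power_mult_distrib)
qed

text \<open>Periodicity is carried along because the induction step applies
  \<open>prob_periodic_Int\<close> to the intersection built so far.\<close>

lemma prob_periodic_INT:
  fixes S :: "nat \<Rightarrow> (nat \<Rightarrow> int ^ 'i::finite) set"
  assumes "finite F" "\<And>p. p \<in> F \<Longrightarrow> prime p" "\<And>p. p \<in> F \<Longrightarrow> periodic k p (S p)"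
  shows "periodic k (\<Prod>F) (\<Inter>p\<in>F. S p) \<and>
    measure_pmf.prob (random_points k (\<Prod>F)) (\<Inter>p\<in>F. S p) =
    (\<Prod>p\<in>F. measure_pmf.prob (random_points k p) (S p))"
  using assms
proof (induction F)
  case empty
  show ?case by (simp add: periodic_def)
next
  case (insert p F)
  then have IH: "periodic k (\<Prod>F) (\<Inter>p\<in>F. S p)"
    "measure_pmf.prob (random_points k (\<Prod>F)) (\<Inter>p\<in>F. S p) =
    (\<Prod>p\<in>F. measure_pmf.prob (random_points k p) (S p))" by auto
  have p: "prime p" "periodic k p (S p)" using insert.prems by auto
  have cop: "coprime p (\<Prod>F)"
    using insert.hyps(2) insert.prems(1) by (intro prod_coprime_right primes_coprime) auto
  have pos: "p > 0" "\<Prod>F > 0"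
    using insert.prems(1) by (auto intro!: prod_pos simp: prime_gt_0_nat)
  have "periodic k (p * \<Prod>F) (S p \<inter> (\<Inter>p\<in>F. S p))"
    using periodic_mult[OF p(2), of "\<Prod>F"] periodic_mult[OF IH(1), of p]
    by (intro periodic_Int) (simp_all add: mult.commute)
  moreover have "measure_pmf.prob (random_points k (p * \<Prod>F)) (S p \<inter> (\<Inter>p\<in>F. S p)) =
     measure_pmf.prob (random_points k p) (S p) *
     (\<Prod>p\<in>F. measure_pmf.prob (random_points k p) (S p))"
    using prob_periodic_Int[OF p(2) IH(1) cop pos] IH(2) by simp
  ultimately show ?case using insert.hyps by simp
qed

lemma configs_mono: "a \<le> b \<Longrightarrow> configs k a \<subseteq> configs k b"
  unfolding configs_def PiE_dflt_def lattice_box_def by fastforce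

text \<open>The side n lies between two consecutive multiples of m, where the count is known exactly
  by \<open>cnt\<close>. The ratio of either multiple to n tends to 1.\<close>

lemma prob_periodic_limit:
  fixes S :: "(nat \<Rightarrow> int ^ 'i::finite) set"
  assumes per: "periodic k m S" and m: "m > 0"
  shows "(\<lambda>n. measure_pmf.prob (random_points k n) S) \<longlonglongrightarrow> measure_pmf.prob (random_points k m) S"
proof -
  define P where "P = measure_pmf.prob (random_points k m) S"
  have cnt: "real (card (S \<inter> configs k (m * t))) = P * (real (m * t) ^ CARD('i)) ^ k" for t
    using m unfolding P_def card_periodic_multiple[OF per m]
    by (simp add: prob_random_points power_mult_distrib)
  have quot: "(\<lambda>n. real (n div m) / real n) \<longlonglongrightarrow> 1 / real m"
  proof (rule tendsto_sandwich)
    show "\<forall>\<^sub>F n in sequentially. 1 / real m - 1 / real n \<le> real (n div m) / real n"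
    proof (rule eventually_mono[OF eventually_gt_at_top[of 0]])
      fix n :: nat assume n: "n > 0"
      have "real n \<le> real (m * (n div m) + m)"
        using m by (intro of_nat_mono) (metis add_left_mono less_imp_le mod_less_divisor mult_div_mod_eq)
      then have "real n / real m \<le> real (n div m) + 1"
        using m by (simp add: field_simps)
      then have "real n / real m / real n \<le> (real (n div m) + 1) / real n"
        by (rule divide_right_mono) simp
      then show "1 / real m - 1 / real n \<le> real (n div m) / real n"
        using n by (simp add: add_divide_distrib)
    qed
    show "\<forall>\<^sub>F n in sequentially. real (n div m) / real n \<le> 1 / real m"
    proof (rule eventually_mono[OF eventually_gt_at_top[of 0]])
      fix n :: nat assume n: "n > 0"
      have "real (m * (n div m)) \<le> real n" by (intro of_nat_mono) simp
      then show "real (n div m) / real n \<le> 1 / real m" using m n by (simp add: field_simps)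
    qed
    have "(\<lambda>n. 1 / real m - 1 / real n) \<longlonglongrightarrow> 1 / real m - 0"
      by (intro tendsto_intros lim_1_over_n)
    then show "(\<lambda>n. 1 / real m - 1 / real n) \<longlonglongrightarrow> 1 / real m" by simp
  qed auto
  have l1: "(\<lambda>n. P * ((real m * (real (n div m) / real n)) ^ CARD('i)) ^ k) \<longlonglongrightarrow> P * ((real m * (1 / real m)) ^ CARD('i)) ^ k"
    by (intro tendsto_intros quot)
  \<comment> \<open>The summand 1/n is the extra period in the upper multiple
    \<open>m * (n div m + 1)\<close>.\<close>
  have l2: "(\<lambda>n. P * ((real m * (real (n div m) / real n + 1 / real n)) ^ CARD('i)) ^ k) \<longlonglongrightarrow> P * ((real m * (1 / real m + 0)) ^ CARD('i)) ^ k"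
    by (intro tendsto_intros quot lim_1_over_n)
  show ?thesis
    unfolding P_def[symmetric]
  proof (rule tendsto_sandwich)
    show "\<forall>\<^sub>F n in sequentially. P * ((real m * (real (n div m) / real n)) ^ CARD('i)) ^ k \<le> measure_pmf.prob (random_points k n) S"
    proof (rule eventually_mono[OF eventually_gt_at_top[of 0]])
      fix n :: nat assume n: "n > 0"
      have "card (S \<inter> configs k (m * (n div m))) \<le> card (S \<inter> configs k n)"
        by (intro card_mono) (use configs_mono[of "m * (n div m)" n k] in auto)
      then have "P * (real (m * (n div m)) ^ CARD('i)) ^ k \<le> real (card (S \<inter> configs k n))"
        unfolding cnt[symmetric] by simp
      then show "P * ((real m * (real (n div m) / real n)) ^ CARD('i)) ^ k \<le> measure_pmf.prob (random_points k n) S"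
        using n by (simp add: prob_random_points power_divide power_mult_distrib divide_right_mono)
    qed
    show "\<forall>\<^sub>F n in sequentially. measure_pmf.prob (random_points k n) S \<le> P * ((real m * (real (n div m) / real n + 1 / real n)) ^ CARD('i)) ^ k"
    proof (rule eventually_mono[OF eventually_gt_at_top[of 0]])
      fix n :: nat assume n: "n > 0"
      have "n \<le> m * (n div m + 1)"
        using m by (metis add_left_mono less_imp_le mod_less_divisor mult_div_mod_eq distrib_left mult.right_neutral)
      then have "card (S \<inter> configs k n) \<le> card (S \<inter> configs k (m * (n div m + 1)))"
        by (intro card_mono) (use configs_mono[of n "m * (n div m + 1)" k] in auto)
      then have "real (card (S \<inter> configs k n)) \<le> P * (real (m * (n div m + 1)) ^ CARD('i)) ^ k"
        unfolding cnt[symmetric] by simp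
      moreover have "real (n div m) / real n + 1 / real n = real (n div m + 1) / real n"
        by (simp add: add_divide_distrib)
      moreover have "P * ((real m * (real (n div m + 1) / real n)) ^ CARD('i)) ^ k
          = P * (real (m * (n div m + 1)) ^ CARD('i)) ^ k / (real n ^ CARD('i)) ^ k"
        by (simp only: of_nat_mult power_divide times_divide_eq_right)
      ultimately show "measure_pmf.prob (random_points k n) S \<le> P * ((real m * (real (n div m) / real n + 1 / real n)) ^ CARD('i)) ^ k"
        using n by (simp only: prob_random_points) (intro divide_right_mono, auto)
    qed
    show "(\<lambda>n. P * ((real m * (real (n div m) / real n)) ^ CARD('i)) ^ k) \<longlonglongrightarrow> P" using l1 m by simp
    show "(\<lambda>n. P * ((real m * (real (n div m) / real n + 1 / real n)) ^ CARD('i)) ^ k) \<longlonglongrightarrow> P" using l2 m by simp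
  qed
qed

subsection \<open>Colourings of a cycle\<close>

text \<open>The functions have the same format as in \<open>configs\<close>, so that configurations
  in a box of side p can be read as colourings. The default d also serves as the erased colour when
  the last vertex is removed.\<close>

definition path_colourings :: "nat \<Rightarrow> 'a \<Rightarrow> 'a set \<Rightarrow> (nat \<Rightarrow> 'a) set" where
  "path_colourings k d B = {f \<in> PiE_dflt {1..k} d (\<lambda>_. B). \<forall>j\<in>{1..<k}. f j \<noteq> f (Suc j)}"

definition cycle_colourings :: "nat \<Rightarrow> 'a \<Rightarrow> 'a set \<Rightarrow> (nat \<Rightarrow> 'a) set" where
  "cycle_colourings k d B = {f \<in> path_colourings k d B. f k \<noteq> f 1}"

lemma finite_path_colourings: "finite B \<Longrightarrow> finite (path_colourings k d B)"
  unfolding path_colourings_def by (rule finite_subset[of _ "PiE_dflt {1..k} d (\<lambda>_. B)"]) auto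

lemma path_colourings_restrict:
  assumes "f \<in> path_colourings (Suc k) d B" "k \<ge> 1"
  shows "f(Suc k := d) \<in> path_colourings k d B"
  using assms by (auto simp: path_colourings_def PiE_dflt_def)

lemma path_colourings_extend:
  assumes "f \<in> path_colourings k d B" "k \<ge> 1" "b \<in> B" "b \<noteq> f k"
  shows "f(Suc k := b) \<in> path_colourings (Suc k) d B"
  using assms by (auto simp: path_colourings_def PiE_dflt_def less_Suc_eq)

lemma path_colourings_outside: "f \<in> path_colourings k d B \<Longrightarrow> f (Suc k) = d"
  by (auto simp: path_colourings_def PiE_dflt_def)

text \<open>The new end vertex has to avoid exactly one colour, that of its only neighbour.\<close>

lemma card_path_colourings_Suc:
  assumes "finite B" "k \<ge> 1"
  shows "card (path_colourings (Suc k) d B) = card (path_colourings k d B) * (card B - 1)"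
proof -
  let ?S = "SIGMA f:path_colourings k d B. B - {f k}"
  have "bij_betw (\<lambda>f. (f(Suc k := d), f (Suc k))) (path_colourings (Suc k) d B) ?S"
  proof (rule bij_betwI[where g = "\<lambda>(f, b). f(Suc k := b)"])
    show "(\<lambda>f. (f(Suc k := d), f (Suc k))) \<in> path_colourings (Suc k) d B \<rightarrow> ?S"
    proof
      fix f assume f: "f \<in> path_colourings (Suc k) d B"
      then have "f (Suc k) \<in> B" "f (Suc k) \<noteq> f k"
        using assms(2) by (force simp: path_colourings_def PiE_dflt_def)+
      then show "(f(Suc k := d), f (Suc k)) \<in> ?S" using path_colourings_restrict[OF f assms(2)] by simp
    qed
    show "(\<lambda>(f, b). f(Suc k := b)) \<in> ?S \<rightarrow> path_colourings (Suc k) d B"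
      using path_colourings_extend assms(2) by fastforce
    show "(case (f(Suc k := d), f (Suc k)) of (f, b) \<Rightarrow> f(Suc k := b)) = f" for f :: "nat \<Rightarrow> 'a" by simp
    show "((case y of (f, b) \<Rightarrow> f(Suc k := b))(Suc k := d), (case y of (f, b) \<Rightarrow> f(Suc k := b)) (Suc k)) = y"
      if "y \<in> ?S" for y using that path_colourings_outside[of "fst y" k d B] by (auto simp: fun_eq_iff)
  qed
  then have "card (path_colourings (Suc k) d B) = card ?S" by (rule bij_betw_same_card)
  also have "\<dots> = (\<Sum>f\<in>path_colourings k d B. card (B - {f k}))"
    using assms by (intro card_SigmaI) (auto simp: finite_path_colourings)
  also have "\<dots> = (\<Sum>f\<in>path_colourings k d B. card B - 1)"
    using assms by (intro sum.cong refl card_Diff_singleton) (auto simp: path_colourings_def PiE_dflt_def)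
  finally show ?thesis by simp
qed

lemma card_path_colourings_1: "card (path_colourings 1 d B) = card B"
proof -
  have "bij_betw (\<lambda>f. f 1) (path_colourings 1 d B) B"
    by (rule bij_betwI[where g = "\<lambda>b. (\<lambda>_. d)(1 := b)"])
      (auto simp: path_colourings_def PiE_dflt_def fun_eq_iff)
  then show ?thesis by (rule bij_betw_same_card)
qed

lemma card_path_colourings:
  "finite B \<Longrightarrow> card (path_colourings (Suc k) d B) = card B * (card B - 1) ^ k"
proof (induction k)
  case (Suc k)
  then show ?case using card_path_colourings_Suc[of B "Suc k" d] by simp
qed (simp add: card_path_colourings_1[simplified])

text \<open>A proper colouring of a path whose two ends agree is a colouring of the cycle obtained by
  gluing the ends, hence the deletion-contraction recursion.\<close>
lemma card_cycle_colourings_Suc: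
  assumes "finite B" "k \<ge> 1"
  shows "card (cycle_colourings (Suc k) d B) + card (cycle_colourings k d B) = card (path_colourings (Suc k) d B)"
proof -
  let ?E = "{f \<in> path_colourings (Suc k) d B. f (Suc k) = f 1}"
  have "bij_betw (\<lambda>f. f(Suc k := d)) ?E (cycle_colourings k d B)"
  proof (rule bij_betwI[where g = "\<lambda>f. f(Suc k := f 1)"])
    show "(\<lambda>f. f(Suc k := d)) \<in> ?E \<rightarrow> cycle_colourings k d B"
    proof
      fix f assume f: "f \<in> ?E"
      then have "f k \<noteq> f 1" using assms(2) by (force simp: path_colourings_def)
      then show "f(Suc k := d) \<in> cycle_colourings k d B"
        using f path_colourings_restrict[of f k d B] assms(2) by (simp add: cycle_colourings_def)
    qed
    show "(\<lambda>f. f(Suc k := f 1)) \<in> cycle_colourings k d B \<rightarrow> ?E"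
    proof
      fix f assume f: "f \<in> cycle_colourings k d B"
      then have "f 1 \<in> B" "f 1 \<noteq> f k"
        using assms(2) by (auto simp: cycle_colourings_def path_colourings_def PiE_dflt_def)
      then show "f(Suc k := f 1) \<in> ?E"
        using f path_colourings_extend[of f k d B "f 1"] assms(2) by (simp add: cycle_colourings_def)
    qed
  next
    fix f assume "f \<in> ?E"
    then have "f (Suc k) = f 1" by simp
    then show "(f(Suc k := d))(Suc k := (f(Suc k := d)) 1) = f" using assms(2) by (auto simp: fun_eq_iff)
  next
    fix f assume "f \<in> cycle_colourings k d B"
    then show "(f(Suc k := f 1))(Suc k := d) = f"
      using path_colourings_outside by (fastforce simp: cycle_colourings_def)
  qed
  then have E: "card ?E = card (cycle_colourings k d B)" by (rule bij_betw_same_card)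
  have "path_colourings (Suc k) d B = cycle_colourings (Suc k) d B \<union> ?E" by (auto simp: cycle_colourings_def)
  then have "card (path_colourings (Suc k) d B) = card (cycle_colourings (Suc k) d B \<union> ?E)" by simp
  also have "\<dots> = card (cycle_colourings (Suc k) d B) + card ?E"
    using finite_path_colourings[OF assms(1), of "Suc k" d]
    by (intro card_Un_disjoint) (auto simp: cycle_colourings_def)
  finally show ?thesis using E by simp
qed

text \<open>With q colours and c(k) proper colourings of the k-cycle, the recursion reads c(k+1) = q
  (q - 1)^k - c(k), and the closed form satisfies it.\<close>

lemma card_cycle_colourings:
  assumes "finite B" "card B \<ge> 1"
  shows "real (card (cycle_colourings (Suc k) d B)) = (real (card B) - 1) ^ Suc k + (-1) ^ Suc k * (real (card B) - 1)"
proof (induction k)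
  case 0
  \<comment> \<open>The 1-cycle is a loop: its vertex would have to differ from itself. The closed
    form gives (q - 1) - (q - 1) = 0.\<close>
  have "cycle_colourings (Suc 0) d B = {}" by (auto simp: cycle_colourings_def)
  then show ?case by simp
next
  case (Suc k)
  have "real (card (cycle_colourings (Suc (Suc k)) d B)) + real (card (cycle_colourings (Suc k) d B)) =
    real (card B * (card B - 1) ^ Suc k)"
    using card_cycle_colourings_Suc[OF assms(1), of "Suc k" d] card_path_colourings[OF assms(1), of "Suc k" d]
    by (simp flip: of_nat_add)
  also have "\<dots> = real (card B) * (real (card B) - 1) ^ Suc k" using assms(2) by (simp add: of_nat_diff)
  finally show ?case using Suc by (simp add: algebra_simps)
qed

subsection \<open>The Euler product\<close>

text \<open>What remains of the zeta series after sieving by the primes below N. It interpolates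
  between zeta(s) at N = 0 and the limit 1.\<close>

definition rough_sum :: "nat \<Rightarrow> nat \<Rightarrow> real" where
  "rough_sum s N = (\<Sum>m. if m > 0 \<and> (\<forall>p. prime p \<and> p < N \<longrightarrow> \<not> p dvd m) then 1 / real m ^ s else 0)"

lemma summable_inverse_power: "s \<ge> 2 \<Longrightarrow> summable (\<lambda>m. 1 / real m ^ s)"
  using inverse_power_summable[of s, where 'a = real] by (simp add: inverse_eq_divide)

lemma summable_inverse_power_if: "s \<ge> 2 \<Longrightarrow> summable (\<lambda>m. if P m then 1 / real m ^ s else 0)"
  by (rule summable_comparison_test'[OF summable_inverse_power, of s 0]) auto

lemma rough_sum_0:
  assumes "s \<ge> 2"
  shows "rough_sum s 0 = zeta s"
proof -
  have "summable (\<lambda>m. if m > 0 then 1 / real m ^ s else 0)" by (rule summable_inverse_power_if[OF assms])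
  from suminf_split_head[OF this] show ?thesis by (simp add: rough_sum_def zeta_def)
qed

text \<open>One sieve step. For prime N the terms to be removed are those at N m, where m has no
  prime factor below N; together they make up N^(-s) times the current sum.\<close>

lemma rough_sum_Suc:
  assumes s: "s \<ge> 2"
  shows "rough_sum s (Suc N) = (if prime N then 1 - 1 / real N ^ s else 1) * rough_sum s N"
proof (cases "prime N")
  case False
  then have "(\<forall>p. prime p \<and> p < Suc N \<longrightarrow> \<not> p dvd m) \<longleftrightarrow> (\<forall>p. prime p \<and> p < N \<longrightarrow> \<not> p dvd m)" for m
    by (metis less_Suc_eq)
  then show ?thesis using False by (simp add: rough_sum_def)
next
  case True
  define R where "R = (\<lambda>m. m > 0 \<and> (\<forall>p. prime p \<and> p < N \<longrightarrow> \<not> p dvd m))"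
  define f where "f = (\<lambda>m. if R m then 1 / real m ^ s else 0)"
  define g where "g = (\<lambda>m. if N dvd m \<and> R m then 1 / real m ^ s else 0)"
  have N0: "N > 0" using True prime_gt_0_nat by blast
  have sf: "summable f" unfolding f_def by (rule summable_inverse_power_if[OF s])
  have sg: "summable g" unfolding g_def by (rule summable_inverse_power_if[OF s])
  \<comment> \<open>A prime below the prime N cannot divide N, so the factor N does not affect the
    sieve condition.\<close>
  have R_mult: "R (N * m) \<longleftrightarrow> R m" for m
  proof -
    have "p dvd N * m \<longleftrightarrow> p dvd m" if "prime p" "p < N" for p
      using that True by (metis prime_dvd_mult_iff primes_dvd_imp_eq less_irrefl)
    then show ?thesis using N0 by (auto simp: R_def)
  qed
  have "(\<lambda>m. g (N * m)) sums c \<longleftrightarrow> g sums c" for c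
  proof (rule sums_mono_reindex)
    show "strict_mono ((*) N)" using N0 by (simp add: strict_mono_def)
    show "g n = 0" if "n \<notin> range ((*) N)" for n using that by (auto simp: g_def dvd_def)
  qed
  then have "(\<lambda>m. g (N * m)) sums suminf g" using sg by (simp add: summable_sums)
  moreover have "g (N * m) = 1 / real N ^ s * f m" for m
    by (auto simp: g_def f_def R_mult power_mult_distrib)
  moreover have "(\<lambda>m. 1 / real N ^ s * f m) sums (1 / real N ^ s * suminf f)"
    by (intro sums_mult summable_sums sf)
  ultimately have g: "suminf g = 1 / real N ^ s * suminf f" using sums_unique2 by fastforce
  have "rough_sum s (Suc N) = (\<Sum>m. f m - g m)"
    unfolding rough_sum_def
  proof (rule suminf_cong)
    fix m
    have "(m > 0 \<and> (\<forall>p. prime p \<and> p < Suc N \<longrightarrow> \<not> p dvd m)) \<longleftrightarrow> R m \<and> \<not> N dvd m"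
      unfolding R_def less_Suc_eq using True by blast
    then show "(if m > 0 \<and> (\<forall>p. prime p \<and> p < Suc N \<longrightarrow> \<not> p dvd m) then 1 / real m ^ s else 0) = f m - g m"
      by (simp add: f_def g_def)
  qed
  also have "\<dots> = suminf f - suminf g" using suminf_diff[OF sf sg] by simp
  finally show ?thesis
    using True g by (simp add: rough_sum_def f_def R_def algebra_simps)
qed

lemma rough_sum_eq: "s \<ge> 2 \<Longrightarrow> rough_sum s N = (\<Prod>p<N. if prime p then 1 - 1 / real p ^ s else 1) * zeta s"
  by (induction N) (simp_all add: rough_sum_0 rough_sum_Suc)

lemma tail_inverse_power_tendsto_0:
  "s \<ge> 2 \<Longrightarrow> (\<lambda>N. \<Sum>m. 1 / real (m + N) ^ s) \<longlonglongrightarrow> 0"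
  by (rule suminf_exist_split2[OF summable_inverse_power])

text \<open>Every m with 1 < m < N has a prime factor below N, so 1 is the only surviving index
  below N. The terms from N on are bounded by the full tail.\<close>

lemma rough_sum_bounds:
  assumes s: "s \<ge> 2" and N: "N \<ge> 2"
  shows "1 \<le> rough_sum s N" "rough_sum s N \<le> 1 + (\<Sum>m. 1 / real (m + N) ^ s)"
proof -
  define f where "f = (\<lambda>m. if m > 0 \<and> (\<forall>p. prime p \<and> p < N \<longrightarrow> \<not> p dvd m) then 1 / real m ^ s else 0)"
  have sf: "summable f" unfolding f_def by (rule summable_inverse_power_if[OF s])
  have f0: "f m \<ge> 0" for m by (simp add: f_def)
  have f1: "f 1 = 1" by (auto simp: f_def)
  have small: "f m = 0" if m: "m < N" "m \<noteq> 1" for m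
  proof (cases "m = 0")
    case False
    then obtain p where p: "prime p" "p dvd m" using m(2) prime_factor_nat[of m] by blast
    then have "p < N" using m False by (meson dvd_imp_le le_less_trans bot_nat_0.not_eq_extremum)
    then show ?thesis using p by (auto simp: f_def)
  qed (simp add: f_def)
  have "(\<Sum>m<N. f m) = (\<Sum>m\<in>{1}. f m)"
    using N small by (intro sum.mono_neutral_right) auto
  then have head: "(\<Sum>m<N. f m) = 1" using f1 by simp
  have split: "rough_sum s N = (\<Sum>m. f (m + N)) + 1"
    using suminf_split_initial_segment[OF sf, of N] head by (simp add: rough_sum_def f_def)
  have sf': "summable (\<lambda>m. f (m + N))" using sf by (rule summable_ignore_initial_segment)
  show "1 \<le> rough_sum s N" unfolding split using suminf_nonneg[OF sf'] f0 by simp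
  have "(\<Sum>m. f (m + N)) \<le> (\<Sum>m. 1 / real (m + N) ^ s)"
    by (intro suminf_le sf' summable_ignore_initial_segment summable_inverse_power s) (simp add: f_def)
  then show "rough_sum s N \<le> 1 + (\<Sum>m. 1 / real (m + N) ^ s)" unfolding split by simp
qed

lemma zeta_pos:
  assumes "s \<ge> 2"
  shows "zeta s > 0"
  unfolding zeta_def
  by (intro suminf_pos) (use summable_ignore_initial_segment[OF summable_inverse_power[OF assms], of 1] in auto)

lemma euler_product:
  assumes s: "s \<ge> 2"
  shows "(\<lambda>N. \<Prod>p<N. if prime p then 1 - 1 / real p ^ s else 1) \<longlonglongrightarrow> inverse (zeta s)"
proof -
  have "(\<lambda>N. rough_sum s N) \<longlonglongrightarrow> 1"
  proof (rule tendsto_sandwich)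
    show "\<forall>\<^sub>F N in sequentially. 1 \<le> rough_sum s N"
      using rough_sum_bounds(1)[OF s] eventually_at_top_linorder by blast
    show "\<forall>\<^sub>F N in sequentially. rough_sum s N \<le> 1 + (\<Sum>m. 1 / real (m + N) ^ s)"
      using rough_sum_bounds(2)[OF s] eventually_at_top_linorder by blast
    show "(\<lambda>N. 1 + (\<Sum>m. 1 / real (m + N) ^ s)) \<longlonglongrightarrow> 1"
      using tendsto_add[OF tendsto_const tail_inverse_power_tendsto_0[OF s], of 1] by simp
  qed auto
  then have "(\<lambda>N. rough_sum s N * inverse (zeta s)) \<longlonglongrightarrow> 1 * inverse (zeta s)"
    by (intro tendsto_intros)
  moreover have "zeta s \<noteq> 0" using zeta_pos[OF s] by simp
  ultimately show ?thesis by (simp add: rough_sum_eq[OF s] mult.assoc)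
qed

subsection \<open>Visibility and congruences\<close>

text \<open>If p divides all coordinates of Y - X, then X + (Y - X)/p is a lattice point inside the
  segment. Conversely, an inner lattice point X + u (Y - X) forces u to be rational, and its
  denominator divides all coordinates of Y - X. For X = Y both sides fail.\<close>

lemma mutually_visible_iff:
  fixes X Y :: "int ^ 'i::finite"
  shows "X \<diamond> Y \<longleftrightarrow> (\<forall>p::nat. prime p \<longrightarrow> (\<exists>i. X $ i mod int p \<noteq> Y $ i mod int p))"
proof
  assume vis: "X \<diamond> Y"
  show "\<forall>p::nat. prime p \<longrightarrow> (\<exists>i. X $ i mod int p \<noteq> Y $ i mod int p)"
  proof (intro allI impI, rule ccontr)
    fix p :: nat
    assume p: "prime p" and "\<not> (\<exists>i. X $ i mod int p \<noteq> Y $ i mod int p)"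
    then have "\<forall>i. int p dvd Y $ i - X $ i" by (metis mod_eq_dvd_iff)
    then have "\<forall>i. \<exists>d. Y $ i - X $ i = int p * d" by (simp add: dvd_def)
    then obtain d where d: "\<And>i. Y $ i - X $ i = int p * d i" by metis
    have p2: "int p \<ge> 2" using prime_ge_2_nat[OF p] by simp
    define Z where "Z = (\<chi> i. X $ i + d i)"
    have "real_vec Z = (1 - 1 / real p) *\<^sub>R real_vec X + (1 / real p) *\<^sub>R real_vec Y"
    proof (simp add: vec_eq_iff real_vec_def Z_def, intro allI)
      fix i
      have "Y $ i = X $ i + int p * d i" using d[of i] by simp
      then have "real_of_int (Y $ i) = real_of_int (X $ i) + real p * real_of_int (d i)" by simp
      then show "real_of_int (X $ i) + real_of_int (d i) =
         (1 - 1 / real p) * real_of_int (X $ i) + real_of_int (Y $ i) / real p"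
        using p2 by (simp add: field_simps)
    qed
    then have "real_vec Z \<in> closed_segment (real_vec X) (real_vec Y)"
      unfolding in_segment using p2 by (intro exI[of _ "1 / real p"]) auto
    then have Z: "Z = X \<or> Z = Y" and neq: "X \<noteq> Y"
      using vis unfolding mutually_visible_def by auto
    obtain i where i: "X $ i \<noteq> Y $ i" using neq by (auto simp: vec_eq_iff)
    then have di: "d i \<noteq> 0" using d[of i] by auto
    have "Z $ i = X $ i \<or> Z $ i = Y $ i" using Z by auto
    \<comment> \<open>Since \<open>d i\<close> is nonzero, Z differs from X at i, so Z = Y; this
      would make p equal to 1.\<close>
    then have "Y $ i - X $ i = d i" using di by (auto simp: Z_def)
    then have "int p * d i = 1 * d i" using d[of i] by (metis mult_1)
    then have "int p = 1" using di by (metis mult_right_cancel)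
    then show False using p2 by simp
  qed
next
  assume all: "\<forall>p::nat. prime p \<longrightarrow> (\<exists>i. X $ i mod int p \<noteq> Y $ i mod int p)"
  have neq: "X \<noteq> Y" using all two_is_prime_nat by blast
  have "Z = X \<or> Z = Y" if seg: "real_vec Z \<in> closed_segment (real_vec X) (real_vec Y)" for Z
  proof (rule ccontr)
    assume Z: "\<not> (Z = X \<or> Z = Y)"
    obtain u where u: "0 \<le> u" "u \<le> 1" and Zu: "real_vec Z = (1 - u) *\<^sub>R real_vec X + u *\<^sub>R real_vec Y"
      using seg unfolding in_segment by auto
    have co: "real_of_int (Z $ i - X $ i) = u * real_of_int (Y $ i - X $ i)" for i
      using arg_cong[OF Zu, of "\<lambda>v. v $ i"] by (simp add: real_vec_def algebra_simps)
    have u0: "u \<noteq> 0"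
    proof
      assume "u = 0"
      then have "Z $ i = X $ i" for i using co[of i] by simp
      then show False using Z by (simp add: vec_eq_iff)
    qed
    have u1: "u \<noteq> 1"
    proof
      assume "u = 1"
      then have "Z $ i = Y $ i" for i using co[of i] by simp
      then show False using Z by (simp add: vec_eq_iff)
    qed
    obtain i0 where i0: "X $ i0 \<noteq> Y $ i0" using neq by (auto simp: vec_eq_iff)
    have "u = real_of_int (Z $ i0 - X $ i0) / real_of_int (Y $ i0 - X $ i0)"
      using co[of i0] i0 by simp
    then have "u \<in> \<rat>" by (metis Rats_divide Rats_of_int)
    then obtain a b :: int where ab: "b > 0" "coprime a b" "u = of_int a / of_int b"
      by (rule Rats_cases')
    have "b \<noteq> 1"
    proof
      assume "b = 1"
      then have "u = of_int a" using ab by simp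
      then show False using u u0 u1 by auto
    qed
    \<comment> \<open>Because u lies strictly between 0 and 1, its denominator b is not 1, and any
      prime factor of b violates the assumption.\<close>
    then obtain p where p: "prime p" "p dvd nat b" using prime_factor_nat[of "nat b"] ab(1) by force
    then have pb: "int p dvd b" using ab(1) by (metis int_dvd_int_iff int_nat_eq less_imp_le)
    have "int p dvd X $ i - Y $ i" for i
    proof -
      have "real_of_int b * real_of_int (Z $ i - X $ i) = real_of_int a * real_of_int (Y $ i - X $ i)"
        using co[of i] ab by simp
      then have "b * (Z $ i - X $ i) = a * (Y $ i - X $ i)" by (metis of_int_mult of_int_eq_iff)
      then have "b dvd a * (Y $ i - X $ i)" by (metis dvd_triv_left)
      then have "b dvd Y $ i - X $ i" using ab(2) by (metis coprime_commute coprime_dvd_mult_right_iff)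
      then show ?thesis using pb by (metis dvd_trans dvd_diff_commute)
    qed
    then have "\<forall>i. X $ i mod int p = Y $ i mod int p" by (simp add: mod_eq_dvd_iff)
    then show False using all p(1) by blast
  qed
  then show "X \<diamond> Y" using neq unfolding mutually_visible_def by blast
qed

section \<open>Tail estimate for large moduli\<close>

lemma lattice_box_mod_eq:
  fixes x y :: "int ^ 'i"
  assumes "x \<in> lattice_box n" "y \<in> lattice_box n" "n \<le> m"
  shows "(\<forall>i. x $ i mod int m = y $ i mod int m) \<longleftrightarrow> x = y"
proof
  assume eq: "\<forall>i. x $ i mod int m = y $ i mod int m"
  have "x $ i = y $ i" for i
  proof -
    have "int m dvd x $ i - y $ i" using eq by (simp add: mod_eq_dvd_iff)
    moreover have "1 \<le> x $ i" "x $ i \<le> int n" "1 \<le> y $ i" "y $ i \<le> int n"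
      using assms by (auto simp: lattice_box_def)
    ultimately show ?thesis using assms(3) dvd_imp_le_int[of "x $ i - y $ i" "int m"] by linarith
  qed
  then show "x = y" by (simp add: vec_eq_iff)
qed simp

text \<open>Members of one class are told apart by their quotients, which range over 0, ...,
  \<open>n div d\<close>.\<close>

lemma card_residue_class_le:
  assumes "d > 0"
  shows "card {y \<in> {1..int n}. y mod int d = x mod int d} \<le> n div d + 1"
proof -
  let ?A = "{y \<in> {1..int n}. y mod int d = x mod int d}"
  have "inj_on (\<lambda>y. y div int d) ?A"
  proof (rule inj_onI)
    fix y z assume "y \<in> ?A" "z \<in> ?A" and "y div int d = z div int d"
    then have "y div int d = z div int d" "y mod int d = z mod int d" by auto
    then show "y = z" by (metis div_mult_mod_eq)
  qed
  moreover have "(\<lambda>y. y div int d) ` ?A \<subseteq> {0..int (n div d)}"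
    using assms by (auto simp: zdiv_int pos_imp_zdiv_nonneg_iff intro!: zdiv_mono1)
  ultimately have "card ?A \<le> card {0..int (n div d)}" by (rule card_inj_on_le) simp
  then show ?thesis by (simp add: nat_add_distrib)
qed

lemma card_box_residue_class_le:
  fixes x :: "int ^ 'i::finite"
  assumes "d > 0"
  shows "card {y \<in> lattice_box n. \<forall>i. x $ i mod int d = y $ i mod int d} \<le> (n div d + 1) ^ CARD('i)"
proof -
  have "{y \<in> lattice_box n. \<forall>i. x $ i mod int d = y $ i mod int d} =
    {y. \<forall>i. y $ i \<in> {y \<in> {1..int n}. y mod int d = x $ i mod int d}}"
    by (auto simp: lattice_box_def)
  then have "card {y \<in> lattice_box n. \<forall>i. x $ i mod int d = y $ i mod int d} =
    (\<Prod>i\<in>UNIV. card {y \<in> {1..int n}. y mod int d = x $ i mod int d})"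
    by (simp only: card_vec_Pi)
  also have "\<dots> \<le> (\<Prod>i\<in>(UNIV :: 'i set). n div d + 1)"
    by (intro prod_mono conjI card_residue_class_le assms) simp
  finally show ?thesis by simp
qed

text \<open>A modulus d >= n only admits y = x, which costs n^(-s) once for all such d. For N <= d <
  n the residue class is counted, and these counts are summed. The bound is uniform in x, as needed
  for conditioning later.\<close>

lemma prob_box_residue_class_le:
  fixes x :: "int ^ 'i::finite"
  assumes x: "x \<in> lattice_box n" and n: "n > 0" and N: "N > 0" and s: "CARD('i) \<ge> 2"
  shows "measure_pmf.prob (pmf_of_set (lattice_box n))
      {y. \<exists>d\<ge>N. \<forall>i. x $ i mod int d = y $ i mod int d}
    \<le> 1 / real n ^ CARD('i) + 2 ^ CARD('i) * (\<Sum>m. 1 / real (m + N) ^ CARD('i))"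
proof -
  let ?s = "CARD('i)"
  define C where "C = (\<lambda>d. {y \<in> lattice_box n. \<forall>i. x $ i mod int d = y $ i mod int d})"
  have sub: "lattice_box n \<inter> {y. \<exists>d\<ge>N. \<forall>i. x $ i mod int d = y $ i mod int d} \<subseteq> {x} \<union> (\<Union>d\<in>{N..<n}. C d)"
  proof
    fix y assume "y \<in> lattice_box n \<inter> {y. \<exists>d\<ge>N. \<forall>i. x $ i mod int d = y $ i mod int d}"
    then obtain d where y: "y \<in> lattice_box n" and d: "d \<ge> N" "\<forall>i. x $ i mod int d = y $ i mod int d" by auto
    show "y \<in> {x} \<union> (\<Union>d\<in>{N..<n}. C d)"
    proof (cases "d < n")
      case True
      then show ?thesis using y d by (auto simp: C_def)
    next
      case False
      then show ?thesis using lattice_box_mod_eq[OF x y, of d] d by simp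
    qed
  qed
  have div_power: "(real (n div d + 1) / real n) ^ ?s = real ((n div d + 1) ^ ?s) / real n ^ ?s" for d
    by (simp only: power_divide of_nat_power)
  have finC: "finite (C d)" for d unfolding C_def by simp
  have "card (lattice_box n \<inter> {y. \<exists>d\<ge>N. \<forall>i. x $ i mod int d = y $ i mod int d}) \<le> card ({x} \<union> (\<Union>d\<in>{N..<n}. C d))"
    using sub finC by (intro card_mono) auto
  also have "\<dots> \<le> card {x} + card (\<Union>d\<in>{N..<n}. C d)" by (rule card_Un_le)
  also have "\<dots> \<le> 1 + (\<Sum>d\<in>{N..<n}. card (C d))" using card_UN_le[of "{N..<n}" C] by simp
  also have "\<dots> \<le> 1 + (\<Sum>d\<in>{N..<n}. (n div d + 1) ^ ?s)"
    unfolding C_def using N by (intro add_left_mono sum_mono card_box_residue_class_le) auto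
  finally have "real (card (lattice_box n \<inter> {y. \<exists>d\<ge>N. \<forall>i. x $ i mod int d = y $ i mod int d}))
     \<le> real (1 + (\<Sum>d\<in>{N..<n}. (n div d + 1) ^ ?s))" by (rule of_nat_mono)
  then have "measure_pmf.prob (pmf_of_set (lattice_box n))
      {y. \<exists>d\<ge>N. \<forall>i. x $ i mod int d = y $ i mod int d} \<le> real (1 + (\<Sum>d\<in>{N..<n}. (n div d + 1) ^ ?s)) / real n ^ ?s"
    unfolding measure_pmf_of_set[OF lattice_box_nonempty[OF n] finite_lattice_box] card_lattice_box of_nat_power
    by (rule divide_right_mono) simp
  also have "\<dots> = 1 / real n ^ ?s + (\<Sum>d\<in>{N..<n}. (real (n div d + 1) / real n) ^ ?s)"
    by (simp only: div_power of_nat_add[of 1] of_nat_1 of_nat_sum add_divide_distrib sum_divide_distrib)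
  also have "(\<Sum>d\<in>{N..<n}. (real (n div d + 1) / real n) ^ ?s) \<le> (\<Sum>d\<in>{N..<n}. 2 ^ ?s * (1 / real d ^ ?s))"
  proof (rule sum_mono)
    fix d assume d: "d \<in> {N..<n}"
    then have d0: "d > 0" "d \<le> n" using N by auto
    \<comment> \<open>Origin of the constant 2^s: as d is at most n, rounding up adds at most n to d
      times the quotient.\<close>
    have "d * (n div d + 1) \<le> 2 * n" using d0 by (simp add: add_mono mult_2)
    then have "real d * real (n div d + 1) \<le> 2 * real n" by (metis of_nat_mono of_nat_mult of_nat_numeral)
    then have "real (n div d + 1) / real n \<le> 2 / real d" using d0 n by (simp add: field_simps)
    then have "(real (n div d + 1) / real n) ^ ?s \<le> (2 / real d) ^ ?s" by (rule power_mono) simp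
    then show "(real (n div d + 1) / real n) ^ ?s \<le> 2 ^ ?s * (1 / real d ^ ?s)" by (simp add: power_divide)
  qed
  also have "(\<Sum>d\<in>{N..<n}. 2 ^ ?s * (1 / real d ^ ?s)) = 2 ^ ?s * (\<Sum>d\<in>{N..<n}. 1 / real d ^ ?s)"
    by (simp add: sum_distrib_left)
  also have "(\<Sum>d\<in>{N..<n}. 1 / real d ^ ?s) \<le> (\<Sum>m. 1 / real (m + N) ^ ?s)"
  proof -
    have "(\<Sum>d\<in>{N..<n}. 1 / real d ^ ?s) = (\<Sum>m<n - N. 1 / real (m + N) ^ ?s)"
      by (rule sum.reindex_bij_witness[of _ "\<lambda>m. m + N" "\<lambda>d. d - N"]) auto
    also have "\<dots> \<le> (\<Sum>m. 1 / real (m + N) ^ ?s)"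
      using summable_ignore_initial_segment[OF summable_inverse_power[OF s], of N] by (intro sum_le_suminf) auto
    finally show ?thesis .
  qed
  finally show ?thesis by simp
qed

text \<open>Condition on all points except the one with index j'. It remains uniform, so a bound
  valid for every fixed value of the point at j survives averaging.\<close>

lemma prob_random_points_pair_le:
  fixes Q :: "int ^ 'i::finite \<Rightarrow> int ^ 'i \<Rightarrow> bool"
  assumes jj: "j \<in> {1..k}" "j' \<in> {1..k}" "j \<noteq> j'" and n: "n > 0" and e: "\<epsilon> \<ge> 0"
    and bound: "\<And>x. x \<in> lattice_box n \<Longrightarrow> measure_pmf.prob (pmf_of_set (lattice_box n)) {y. Q x y} \<le> \<epsilon>"
  shows "measure_pmf.prob (random_points k n) {X. Q (X j) (X j')} \<le> \<epsilon>"
proof -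
  define U where "U = pmf_of_set (lattice_box n :: (int ^ 'i) set)"
  define A where "A = {1..k} - {j'}"
  have A: "finite A" "j' \<notin> A" "{1..k} = insert j' A" "j \<in> A" using jj by (auto simp: A_def)
  have "random_points k n = bind_pmf U (\<lambda>y. bind_pmf (Pi_pmf A 0 (\<lambda>_. U)) (\<lambda>f. return_pmf (f(j' := y))))"
    unfolding random_points_def U_def[symmetric] A(3) by (rule Pi_pmf_insert'[OF A(1,2)])
  \<comment> \<open>The order of sampling is exchanged so that the point at j' is drawn
    last.\<close>
  also have "\<dots> = bind_pmf (Pi_pmf A 0 (\<lambda>_. U)) (\<lambda>f. map_pmf (\<lambda>y. f(j' := y)) U)"
    unfolding map_pmf_def by (rule bind_commute_pmf)
  finally have eq: "random_points k n = bind_pmf (Pi_pmf A 0 (\<lambda>_. U)) (\<lambda>f. map_pmf (\<lambda>y. f(j' := y)) U)" .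
  have "emeasure (random_points k n) {X. Q (X j) (X j')} =
    (\<integral>\<^sup>+f. emeasure U {y. Q (f j) y} \<partial>Pi_pmf A 0 (\<lambda>_. U))"
    unfolding eq using jj(3) by (simp add: vimage_def)
  also have "\<dots> \<le> ennreal \<epsilon>"
  proof (rule measure_pmf.nn_integral_le_const)
    show "AE f in Pi_pmf A 0 (\<lambda>_. U). emeasure U {y. Q (f j) y} \<le> ennreal \<epsilon>"
    proof (rule AE_pmfI)
      fix f assume "f \<in> set_pmf (Pi_pmf A 0 (\<lambda>_. U))"
      then have "f j \<in> set_pmf U" using set_Pi_pmf_subset'[OF A(1), of 0 "\<lambda>_. U"] A(4)
        by (auto simp: PiE_dflt_def)
      then have "f j \<in> lattice_box n"
        using n by (simp add: U_def set_pmf_of_set lattice_box_nonempty)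
      from bound[OF this] show "emeasure U {y. Q (f j) y} \<le> ennreal \<epsilon>"
        by (simp add: U_def measure_pmf.emeasure_eq_measure ennreal_leI)
    qed
  qed simp
  finally show ?thesis using e by (simp add: measure_pmf.emeasure_eq_measure)
qed

section \<open>The cyclic condition modulo one integer\<close>

definition cyc_succ :: "nat \<Rightarrow> nat \<Rightarrow> nat" where
  "cyc_succ k j = (if j = k then 1 else Suc j)"

lemma cyc_succ_in: "j \<in> {1..k} \<Longrightarrow> cyc_succ k j \<in> {1..k}"
  by (auto simp: cyc_succ_def)

text \<open>This is what makes the two ends of an edge distinct indices, hence independent
  points.\<close>

lemma cyc_succ_neq: "k \<ge> 2 \<Longrightarrow> cyc_succ k j \<noteq> j"
  by (auto simp: cyc_succ_def)

lemma Ball_cyc_succ: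
  assumes "k \<ge> 1"
  shows "(\<forall>j\<in>{1..k}. P j (cyc_succ k j)) \<longleftrightarrow> (\<forall>j\<in>{1..<k}. P j (Suc j)) \<and> P k 1"
proof -
  have "{1..k} = insert k {1..<k}" using assms by auto
  then show ?thesis by (auto simp: cyc_succ_def)
qed

definition distinct_mod :: "nat \<Rightarrow> nat \<Rightarrow> (nat \<Rightarrow> int ^ 'i) set" where
  "distinct_mod k p = {X. \<forall>j\<in>{1..k}. \<exists>i. X j $ i mod int p \<noteq> X (cyc_succ k j) $ i mod int p}"

lemma periodic_distinct_mod: "periodic k p (distinct_mod k p)"
  unfolding periodic_def
proof (intro allI impI)
  fix X Y :: "nat \<Rightarrow> int ^ 'a"
  assume eq: "\<forall>j\<in>{1..k}. \<forall>i. X j $ i mod int p = Y j $ i mod int p"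
  have "X (cyc_succ k j) $ i mod int p = Y (cyc_succ k j) $ i mod int p" if "j \<in> {1..k}" for j i
    using eq cyc_succ_in[OF that] by blast
  then show "X \<in> distinct_mod k p \<longleftrightarrow> Y \<in> distinct_mod k p"
    using eq by (simp add: distinct_mod_def)
qed

text \<open>In a box of side p every residue vector modulo p has exactly one representative, so
  congruence is equality. The points of the box act as p^s colours on the vertices of a
  k-cycle.\<close>

lemma distinct_mod_Int_configs:
  assumes "k \<ge> 1"
  shows "distinct_mod k p \<inter> configs k p = cycle_colourings k 0 (lattice_box p :: (int ^ 'i::finite) set)"
proof -
  have "X \<in> distinct_mod k p \<longleftrightarrow> (\<forall>j\<in>{1..k}. X j \<noteq> X (cyc_succ k j))"
    if X: "X \<in> configs k p" for X :: "nat \<Rightarrow> int ^ 'i"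
  proof -
    have "X j \<in> lattice_box p" if "j \<in> {1..k}" for j
      using X that by (auto simp: configs_def PiE_dflt_def)
    then have "(\<exists>i. X j $ i mod int p \<noteq> X (cyc_succ k j) $ i mod int p) \<longleftrightarrow> X j \<noteq> X (cyc_succ k j)"
      if "j \<in> {1..k}" for j
      using lattice_box_mod_eq[of "X j" p "X (cyc_succ k j)" p] that cyc_succ_in[OF that] by blast
    then show ?thesis by (auto simp: distinct_mod_def)
  qed
  moreover have "(\<forall>j\<in>{1..k}. X j \<noteq> X (cyc_succ k j)) \<longleftrightarrow> (\<forall>j\<in>{1..<k}. X j \<noteq> X (Suc j)) \<and> X k \<noteq> X 1"
    for X :: "nat \<Rightarrow> int ^ 'i" by (rule Ball_cyc_succ[OF assms])
  ultimately show ?thesis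
    by (auto simp: cycle_colourings_def path_colourings_def configs_def)
qed

lemma prob_distinct_mod:
  assumes "k \<ge> 1" "p \<ge> 2"
  shows "measure_pmf.prob (random_points k p) (distinct_mod k p :: (nat \<Rightarrow> int ^ 'i::finite) set) =
    (1 - 1 / real p ^ CARD('i)) ^ k * (1 + (-1) ^ k / (real p ^ CARD('i) - 1) ^ (k - 1))"
proof -
  define q where "q = real p ^ CARD('i)"
  obtain l where k: "k = Suc l" using assms(1) by (cases k) auto
  have "real 2 ^ 1 \<le> real p ^ 1" using assms by simp
  also have "\<dots> \<le> real p ^ CARD('i)" using assms(2) by (intro power_increasing) (auto simp: Suc_le_eq)
  finally have q: "q \<ge> 2" by (simp add: q_def)
  have "real (card (cycle_colourings k 0 (lattice_box p :: (int ^ 'i) set))) = (q - 1) ^ k + (-1) ^ k * (q - 1)"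
    unfolding k q_def using assms(2) by (subst card_cycle_colourings) (simp_all add: card_lattice_box)
  then have "measure_pmf.prob (random_points k p) (distinct_mod k p :: (nat \<Rightarrow> int ^ 'i) set) =
    ((q - 1) ^ k + (-1) ^ k * (q - 1)) / q ^ k"
    using assms by (simp add: prob_random_points distinct_mod_Int_configs q_def)
  \<comment> \<open>Extracting (q - 1)^k separates the Euler factor of zeta(s)^(-k) from the
    correction caused by closing the chain.\<close>
  also have "(q - 1) ^ k + (-1) ^ k * (q - 1) = (q - 1) ^ k * (1 + (-1) ^ k / (q - 1) ^ (k - 1))"
    using q by (simp add: k field_simps)
  also have "\<dots> / q ^ k = ((q - 1) / q) ^ k * (1 + (-1) ^ k / (q - 1) ^ (k - 1))"
    by (simp add: power_divide)
  also have "(q - 1) / q = 1 - 1 / q" using q by (simp add: diff_divide_distrib)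
  finally show ?thesis by (simp add: q_def)
qed

text \<open>With q = p^s, a factor deviates from 1 by at most 1/(q - 1), since k - 1 >= 1. As q >=
  2, this is at most 2/q, which is summable.\<close>

lemma convergent_prod_cycle_factor:
  assumes "s \<ge> 2" "k \<ge> 2"
  shows "convergent_prod
    (\<lambda>p::nat. if prime p then 1 + (-1) ^ k / (real p ^ s - 1) ^ (k - 1) else 1)"
proof (rule abs_convergent_prod_imp_convergent_prod, rule summable_imp_abs_convergent_prod,
    rule summable_comparison_test'[where N = 0])
  show "summable (\<lambda>p. 2 * (1 / real p ^ s))"
    by (intro summable_mult summable_inverse_power assms)
  fix p :: nat
  show "norm (norm ((if prime p then 1 + (-1) ^ k / (real p ^ s - 1) ^ (k - 1) else 1) - 1))
      \<le> 2 * (1 / real p ^ s)"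
  proof (cases "prime p")
    case True
    have "real 2 ^ 1 \<le> real p ^ 1" using prime_ge_2_nat[OF True] by simp
    also have "\<dots> \<le> real p ^ s" using prime_ge_2_nat[OF True] assms by (intro power_increasing) auto
    finally have q: "real p ^ s \<ge> 2" by simp
    have le: "1 / (x - 1) \<le> 2 / x" if "x \<ge> 2" for x :: real
      using that by (simp add: field_simps)
    have "(real p ^ s - 1) ^ 1 \<le> (real p ^ s - 1) ^ (k - 1)"
      using assms q by (intro power_increasing) auto
    then have "1 / (real p ^ s - 1) ^ (k - 1) \<le> 1 / (real p ^ s - 1)"
      using q by (intro divide_left_mono) auto
    also have "\<dots> \<le> 2 / real p ^ s" using le[OF q] .
    finally show ?thesis using True q by (simp add: power_abs)
  qed simp
qed

text \<open>First N is fixed so that L N is close to l and b N is small, and only then n is taken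
  large. The four quarters of e cover the distances Q to L and L to l and the errors a and
  b.\<close>

lemma tendsto_by_approximation:
  fixes P a b L :: "nat \<Rightarrow> real"
  assumes Q: "\<And>N. Q N \<longlonglongrightarrow> L N" and L: "L \<longlonglongrightarrow> l" and a: "a \<longlonglongrightarrow> 0" and b: "b \<longlonglongrightarrow> 0"
    and upper: "\<And>N n. N > 0 \<Longrightarrow> n > 0 \<Longrightarrow> P n \<le> Q N n"
    and lower: "\<And>N n. N > 0 \<Longrightarrow> n > 0 \<Longrightarrow> Q N n \<le> P n + a n + b N"
  shows "P \<longlonglongrightarrow> l"
proof (rule tendstoI)
  fix e :: real assume "e > 0"
  then have e: "e / 4 > 0" by simp
  have "\<forall>\<^sub>F N in sequentially. N > 0 \<and> dist (L N) l < e / 4 \<and> dist (b N) 0 < e / 4"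
    by (intro eventually_conj eventually_gt_at_top tendstoD[OF L e] tendstoD[OF b e])
  then obtain N where N: "N > 0" "dist (L N) l < e / 4" "dist (b N) 0 < e / 4"
    by (auto dest!: eventually_happens)
  have "\<forall>\<^sub>F n in sequentially. n > 0 \<and> dist (Q N n) (L N) < e / 4 \<and> dist (a n) 0 < e / 4"
    by (intro eventually_conj eventually_gt_at_top tendstoD[OF Q e] tendstoD[OF a e])
  then show "\<forall>\<^sub>F n in sequentially. dist (P n) l < e"
  proof eventually_elim
    case (elim n)
    then show ?case using N upper[of N n] lower[of N n] unfolding dist_real_def by linarith
  qed
qed

subsection \<open>The limit\<close>

text \<open>Convergence belongs to the conclusion so that the infinite product in the limit has its
  genuine meaning.\<close>

theorem theorem1:
  fixes s k :: nat
  assumes "s = CARD('i::finite)" and "s \<ge> 2" and "k \<ge> 2"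
  shows "convergent_prod
           (\<lambda>p::nat. if prime p then 1 + (-1) ^ k / (real p ^ s - 1) ^ (k - 1) else 1)
       \<and> (\<lambda>n. measure_pmf.prob (random_points k n)
              {X :: nat \<Rightarrow> int ^ 'i. (\<forall>j\<in>{1..<k}. X j \<diamond> X (Suc j)) \<and> X k \<diamond> X 1})
         \<longlonglongrightarrow> inverse (zeta s ^ k) *
           (\<Prod>p::nat. if prime p then 1 + (-1) ^ k / (real p ^ s - 1) ^ (k - 1) else 1)"
proof -
  let ?g = "\<lambda>p::nat. if prime p then 1 + (-1) ^ k / (real p ^ s - 1) ^ (k - 1) else 1"
  let ?P = "\<lambda>n S. measure_pmf.prob (random_points k n) (S :: (nat \<Rightarrow> int ^ 'i) set)"
  define V where "V = {X :: nat \<Rightarrow> int ^ 'i. (\<forall>j\<in>{1..<k}. X j \<diamond> X (Suc j)) \<and> X k \<diamond> X 1}"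
  define F where "F = (\<lambda>N. {p::nat. p < N \<and> prime p})"
  define A where "A = (\<lambda>N. \<Inter>p\<in>F N. distinct_mod k p :: (nat \<Rightarrow> int ^ 'i) set)"
  define T where "T = (\<lambda>N. \<Sum>m. 1 / real (m + N) ^ s)"
  have k1: "k \<ge> 1" using assms by simp
  have conv: "convergent_prod ?g" by (rule convergent_prod_cycle_factor[OF assms(2,3)])
  have V: "V = {X. \<forall>p. prime p \<longrightarrow> X \<in> distinct_mod k p}"
  proof -
    have "V = {X. \<forall>j\<in>{1..k}. X j \<diamond> X (cyc_succ k j)}"
      unfolding V_def by (subst Ball_cyc_succ[OF k1]) simp
    then show ?thesis unfolding mutually_visible_iff distinct_mod_def by blast
  qed
  have "(\<lambda>n. ?P n V) \<longlonglongrightarrow> inverse (zeta s ^ k) * prodinf ?g"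
  proof (rule tendsto_by_approximation)
    fix N
    have F: "finite (F N)" "\<And>p. p \<in> F N \<Longrightarrow> prime p" by (auto simp: F_def)
    have per: "periodic k (\<Prod>(F N)) (A N)" and
      prod: "?P (\<Prod>(F N)) (A N) = (\<Prod>p\<in>F N. ?P p (distinct_mod k p))"
      using prob_periodic_INT[OF F periodic_distinct_mod] unfolding A_def by blast+
    have "\<Prod>(F N) > 0" using F(2) by (auto intro!: prod_pos simp: prime_gt_0_nat)
    then have lim: "(\<lambda>n. ?P n (A N)) \<longlonglongrightarrow> ?P (\<Prod>(F N)) (A N)" by (rule prob_periodic_limit[OF per])
    have "?P (\<Prod>(F N)) (A N) = (\<Prod>p\<in>F N. (1 - 1 / real p ^ s) ^ k * ?g p)"
      unfolding prod
      by (intro prod.cong refl) (use F k1 in \<open>simp add: prob_distinct_mod prime_ge_2_nat assms(1)\<close>)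
    also have "\<dots> = (\<Prod>p<N. (if prime p then 1 - 1 / real p ^ s else 1) ^ k * ?g p)"
      by (rule prod.mono_neutral_cong_left) (auto simp: F_def)
    also have "\<dots> = (\<Prod>p<N. if prime p then 1 - 1 / real p ^ s else 1) ^ k * (\<Prod>p<N. ?g p)"
      by (simp only: prod.distrib prod_power_distrib)
    finally show "(\<lambda>n. ?P n (A N)) \<longlonglongrightarrow>
        (\<Prod>p<N. if prime p then 1 - 1 / real p ^ s else 1) ^ k * (\<Prod>p<N. ?g p)"
      using lim by simp
  next
    \<comment> \<open>The convergence theorem for infinite products includes the upper index,
      whereas the products here stop before N.\<close>
    have "(\<lambda>N. \<Prod>p<Suc N. ?g p) \<longlonglongrightarrow> prodinf ?g"
      using convergent_prod_LIMSEQ[OF conv] by (simp only: lessThan_Suc_atMost)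
    then have "(\<lambda>N. \<Prod>p<N. ?g p) \<longlonglongrightarrow> prodinf ?g" by (rule LIMSEQ_imp_Suc)
    then have "(\<lambda>N. (\<Prod>p<N. if prime p then 1 - 1 / real p ^ s else 1) ^ k * (\<Prod>p<N. ?g p))
        \<longlonglongrightarrow> inverse (zeta s) ^ k * prodinf ?g"
      by (intro tendsto_mult tendsto_power euler_product assms(2))
    then show "(\<lambda>N. (\<Prod>p<N. if prime p then 1 - 1 / real p ^ s else 1) ^ k * (\<Prod>p<N. ?g p))
        \<longlonglongrightarrow> inverse (zeta s ^ k) * prodinf ?g"
      by (simp only: power_inverse)
  next
    have "(\<lambda>n. real k * (1 / real n) ^ s) \<longlonglongrightarrow> real k * 0 ^ s"
      by (intro tendsto_intros lim_1_over_n)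
    moreover have "(0 :: real) ^ s = 0" using assms(2) by (simp add: zero_power)
    ultimately show "(\<lambda>n. real k * (1 / real n) ^ s) \<longlonglongrightarrow> 0" by (simp only: mult_zero_right)
    have "(\<lambda>N. real k * 2 ^ s * T N) \<longlonglongrightarrow> real k * 2 ^ s * 0"
      unfolding T_def by (intro tendsto_intros tail_inverse_power_tendsto_0 assms(2))
    then show "(\<lambda>N. real k * 2 ^ s * T N) \<longlonglongrightarrow> 0" by simp
  next
    fix N n :: nat
    have "V \<subseteq> A N" unfolding V A_def F_def by auto
    then show "?P n V \<le> ?P n (A N)" by (intro measure_pmf.finite_measure_mono) auto
  next
    fix N n :: nat assume N: "N > 0" and n: "n > 0"
    \<comment> \<open>Edge j is bad if its ends agree modulo some d >= N. Admitting all integers d,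
      not only primes, enlarges the event to the one bounded by
      \<open>prob_box_residue_class_le\<close>.\<close>
    define B where "B = (\<lambda>j. {X :: nat \<Rightarrow> int ^ 'i.
      \<exists>d\<ge>N. \<forall>i. X j $ i mod int d = X (cyc_succ k j) $ i mod int d})"
    have T0: "T N \<ge> 0" unfolding T_def
      using summable_ignore_initial_segment[OF summable_inverse_power[OF assms(2)], of N]
      by (rule suminf_nonneg) simp
    \<comment> \<open>If a chain passes all primes below N but is not visible, the prime responsible
      is at least N and serves as the modulus d of a bad edge.\<close>
    have "A N \<subseteq> V \<union> (\<Union>j\<in>{1..k}. B j)"
    proof
      fix X assume X: "X \<in> A N"
      show "X \<in> V \<union> (\<Union>j\<in>{1..k}. B j)"
      proof (cases "X \<in> V")
        case False
        then obtain p where p: "prime p" "X \<notin> distinct_mod k p" unfolding V by auto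
        then have "p \<ge> N" using X by (auto simp: A_def F_def not_less[symmetric])
        then show ?thesis using p(2) by (auto simp: distinct_mod_def B_def)
      qed simp
    qed
    then have "?P n (A N) \<le> ?P n (V \<union> (\<Union>j\<in>{1..k}. B j))" by (intro measure_pmf.finite_measure_mono) auto
    also have "\<dots> \<le> ?P n V + ?P n (\<Union>j\<in>{1..k}. B j)" by (rule measure_Un_le) auto
    also have "?P n (\<Union>j\<in>{1..k}. B j) \<le> (\<Sum>j\<in>{1..k}. ?P n (B j))"
      by (rule measure_pmf.finite_measure_subadditive_finite) auto
    also have "\<dots> \<le> (\<Sum>j\<in>{1..k}. 1 / real n ^ s + 2 ^ s * T N)"
    proof (rule sum_mono)
      fix j assume j: "j \<in> {1..k}"
      show "?P n (B j) \<le> 1 / real n ^ s + 2 ^ s * T N"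
        unfolding B_def
      proof (rule prob_random_points_pair_le)
        show "j \<noteq> cyc_succ k j" using cyc_succ_neq[OF assms(3)] by metis
        show "0 \<le> 1 / real n ^ s + 2 ^ s * T N" using T0 by simp
        show "measure_pmf.prob (pmf_of_set (lattice_box n)) {y. \<exists>d\<ge>N. \<forall>i. x $ i mod int d = y $ i mod int d}
          \<le> 1 / real n ^ s + 2 ^ s * T N" if "x \<in> lattice_box n" for x :: "int ^ 'i"
          unfolding T_def assms(1)
          using prob_box_residue_class_le[OF that n N] assms(1,2) by simp
      qed (use j cyc_succ_in n in auto)
    qed
    also have "\<dots> = real k * (1 / real n) ^ s + real k * 2 ^ s * T N"
      by (simp add: algebra_simps power_divide)
    finally show "?P n (A N) \<le> ?P n V + real k * (1 / real n) ^ s + real k * 2 ^ s * T N"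
      by simp
  qed
  then show ?thesis using conv unfolding V_def by blast
qed

end
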